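(* Let $\mathcal C\subset\mathbf S^d_+$ be a set of positive semidefinite $d\times d$ matrices and let $\mathcal P_{\mathcal C}=\{\nu\in\mathcal P_2^\circ:\Sigma_\nu\in\mathcal C\}$. Then for any $\mu\in\mathcal P_2^\circ$, $$W_2(\mu,\mathcal P_{\mathcal C})=W_2(\Sigma_\mu,\mathcal C).$$
   Context: $\mathcal P_2^\circ$ is the set of centered Borel probability measures on $\mathbf R^d$ with finite second moment and $\Sigma_\mu=\mathbb E_\mu[xx^\top]$. On measures, $W_2(\mu,\nu)=\min_{\pi\in\Pi(\mu,\nu)}(\mathbb E_{(x,y)\sim\pi}\|x-y\|_2^2)^{1/2}$ over couplings. On $\mathbf S^d_+$, $W_2$ denotes the Bures–Wasserstein distance $W_2^2(A,B)=\mathrm{tr}\big(A+B-2(A^{1/2}BA^{1/2})^{1/2}\big)$. Distance to a set is the infimum of distances to its elements (with $\inf\emptyset=+\infty$). *)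

theory Defs
  imports "HOL-Probability.Probability"
begin

definition psd :: "(real^'n^'n) set" where
  "psd = {A. transpose A = A \<and> (\<forall>x. 0 \<le> x \<bullet> (A *v x))}"

(* Meaningful only for positive semidefinite A, where the positive semidefinite root is unique. *)
definition msqrt :: "real^'n^'n \<Rightarrow> real^'n^'n" where
  "msqrt A = (THE B. B \<in> psd \<and> B ** B = A)"

definition bures_wasserstein :: "real^'n^'n \<Rightarrow> real^'n^'n \<Rightarrow> real" where
  "bures_wasserstein A B =
     sqrt (trace (A + B - 2 *\<^sub>R msqrt (msqrt A ** B ** msqrt A)))"

definition centered_P2 :: "(real^'n) measure set" where
  "centered_P2 = {\<mu>. prob_space \<mu> \<and> sets \<mu> = sets borel \<and>
     integrable \<mu> (\<lambda>x. (norm x)\<^sup>2) \<and> (LINT x|\<mu>. x) = 0}"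

(* The matrix-valued Bochner integral of the outer product of x with itself;
   the integrand is integrable when the second moment is finite. *)
definition Cov :: "(real^'n) measure \<Rightarrow> real^'n^'n" where
  "Cov \<mu> = (LINT x|\<mu>. (\<chi> i j. x $ i * x $ j))"

definition couplings ::
  "(real^'n) measure \<Rightarrow> (real^'n) measure \<Rightarrow> ((real^'n) \<times> (real^'n)) measure set" where
  "couplings \<mu> \<nu> = {\<pi>. prob_space \<pi> \<and> sets \<pi> = sets borel \<and>
     distr \<pi> borel fst = \<mu> \<and> distr \<pi> borel snd = \<nu>}"

(* Intended for Borel probability measures with finite second moment: there the set of couplings
   is nonempty, the cost is integrable for every coupling, and the infimum is attained. *)
definition wasserstein :: "(real^'n) measure \<Rightarrow> (real^'n) measure \<Rightarrow> real" where
  "wasserstein \<mu> \<nu> =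
     (INF \<pi>\<in>couplings \<mu> \<nu>. sqrt (LINT (x, y)|\<pi>. (norm (x - y))\<^sup>2))"

(* Valued in the extended reals, so that the distance to the empty set is infinity. *)
definition dist_to_set :: "('a \<Rightarrow> 'a \<Rightarrow> real) \<Rightarrow> 'a \<Rightarrow> 'a set \<Rightarrow> ereal" where
  "dist_to_set d a S = (INF b\<in>S. ereal (d a b))"

definition P_cov :: "(real^'n^'n) set \<Rightarrow> (real^'n) measure set" where
  "P_cov C = {\<nu> \<in> centered_P2. Cov \<nu> \<in> C}"

end

(* A coupling of mu and nu has cost tr A + tr B - 2 E<x,y>, where A and B are the covariances, so
   everything rests on E<x,y>. Write R and S for the roots of A and B and P for the root of R B R.

   Upper bound on E<x,y>: 2<x,y> <= |Lx|^2 + |L'y|^2 whenever L^T L' = I, and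
   E|Lx|^2 = |L R|^2 in Frobenius norm. The choice L = H (R + e)^-1, L' = H^-1 (R + e) with
   H^2 = P + d gives E<x,y> <= tr P as e and then d tend to 0.

   Near-optimal coupling: y = M x + N z with M = S W^T (R + e)^-1, W = (P + e)^-1 R S, noise z
   independent of x with covariance I, and N N^T = B - M A M^T, which is positive semidefinite since
   W and R (R + e)^-1 are contractions. Then Cov y = B exactly and E<x,y> >= tr P - O(e).

   The regularisation by e replaces pseudo-inverses and polar decompositions of singular matrices;
   it suffices because both sides are infima. *)
theory Submission
  imports Defs
begin

section \<open>Positive semidefinite square roots\<close>

lemma inner_matrix_left: "(A *v x) \<bullet> y = x \<bullet> (transpose A *v y)" for A :: "real^'n^'m"
  by (metis dot_lmul_matrix transpose_matrix_vector transpose_transpose inner_commute)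

text \<open>A maximiser x of the quadratic form on the unit sphere of S is an eigenvector: the
  residual w = A x - c x lies in S by invariance, and moving from x along w would otherwise raise
  the Rayleigh quotient above c.\<close>

lemma symmetric_eigenvector:
  fixes A :: "real^'n^'n"
  assumes sym: "transpose A = A" and S: "subspace S" and nz: "S \<noteq> {0}"
    and inv: "\<And>x. x \<in> S \<Longrightarrow> A *v x \<in> S"
  obtains x c where "x \<in> S" "norm x = 1" "A *v x = c *\<^sub>R x"
proof -
  have symi: "(A *v x) \<bullet> y = x \<bullet> (A *v y)" for x y
    using inner_matrix_left[of A x y] sym by simp
  obtain z where z: "z \<in> S" "z \<noteq> 0"
    using nz subspace_0[OF S] by auto
  let ?K = "S \<inter> sphere 0 1"
  have "compact ?K"
    by (intro closed_Int_compact closed_subspace S compact_sphere)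
  moreover have "(1 / norm z) *\<^sub>R z \<in> ?K"
    using z S by (auto simp: subspace_scale)
  then have "?K \<noteq> {}" by blast
  moreover have "continuous_on ?K (\<lambda>x. x \<bullet> (A *v x))"
    by (intro continuous_intros)
  ultimately obtain x where x: "x \<in> ?K" and max: "\<And>y. y \<in> ?K \<Longrightarrow> y \<bullet> (A *v y) \<le> x \<bullet> (A *v x)"
    using continuous_attains_sup[of ?K "\<lambda>x. x \<bullet> (A *v x)"] by metis
  define c where "c = x \<bullet> (A *v x)"
  have xS: "x \<in> S" and x1: "x \<bullet> x = 1" using x by (auto simp: dot_square_norm)
  have le: "y \<bullet> (A *v y) \<le> c * (y \<bullet> y)" if "y \<in> S" for y
  proof (cases "y = 0")
    case False
    let ?y = "(1 / norm y) *\<^sub>R y"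
    have "?y \<bullet> (A *v ?y) \<le> c"
      unfolding c_def using that False S by (intro max) (auto simp: subspace_scale)
    also have "?y \<bullet> (A *v ?y) = (y \<bullet> (A *v y)) / (y \<bullet> y)"
      by (simp add: matrix_vector_mult_scaleR dot_square_norm power2_eq_square)
    finally show ?thesis using False by (simp add: pos_divide_le_eq)
  qed simp
  define w where "w = A *v x - c *\<^sub>R x"
  have wS: "w \<in> S" unfolding w_def using xS inv S by (simp add: subspace_diff subspace_scale)
  have xw: "x \<bullet> w = 0" unfolding w_def c_def using x1 by (simp add: inner_diff_right)
  then have wx: "w \<bullet> x = 0" by (simp add: inner_commute)
  have Ax: "A *v x = w + c *\<^sub>R x" by (simp add: w_def)
  have wA: "x \<bullet> (A *v w) = w \<bullet> w"
    unfolding symi[symmetric] Ax using xw by (simp add: inner_add_left)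
  have wAx: "w \<bullet> (A *v x) = w \<bullet> w"
    unfolding Ax using wx by (simp add: inner_add_right)
  \<comment> \<open>Maximality tested at x + t w: the form gains 2 t |w|^2 to first order, while |x
    + t w|^2 has no first-order term because x \<bullet> w = 0.\<close>
  have key: "2 * t * (w \<bullet> w) \<le> t\<^sup>2 * (c * (w \<bullet> w) - w \<bullet> (A *v w))" for t
  proof -
    have "x + t *\<^sub>R w \<in> S" using xS wS S by (simp add: subspace_add subspace_scale)
    note lexw = le[OF this]
    have e1: "(x + t *\<^sub>R w) \<bullet> (A *v (x + t *\<^sub>R w)) = c + 2 * t * (w \<bullet> w) + t\<^sup>2 * (w \<bullet> (A *v w))"
      by (simp add: matrix_vector_right_distrib matrix_vector_mult_scaleR inner_add_left inner_add_right
          wA wAx c_def power2_eq_square distrib_left)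
    have e2: "(x + t *\<^sub>R w) \<bullet> (x + t *\<^sub>R w) = 1 + t\<^sup>2 * (w \<bullet> w)"
      by (simp add: inner_add_left inner_add_right wx xw x1 power2_eq_square)
    from lexw[unfolded e1 e2] show ?thesis by (simp add: algebra_simps)
  qed
  have "w \<bullet> w \<le> 0"
  proof (rule ccontr)
    assume "\<not> w \<bullet> w \<le> 0"
    \<comment> \<open>\<open>q\<close> is a positive bound on the coefficient of t^2, and t = |w|^2
      / q makes t^2 q equal to t |w|^2, half of the left side.\<close>
    define q where "q = \<bar>c * (w \<bullet> w) - w \<bullet> (A *v w)\<bar> + 1"
    define t where "t = (w \<bullet> w) / q"
    have q: "q > 0" by (simp add: q_def add_nonneg_pos)
    have t: "t > 0" unfolding t_def using q \<open>\<not> w \<bullet> w \<le> 0\<close> by (intro divide_pos_pos) linarith+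
    have "2 * t * (w \<bullet> w) \<le> t\<^sup>2 * q"
      by (rule order_trans[OF key mult_left_mono]) (simp_all add: q_def)
    then have "2 * t * (w \<bullet> w) \<le> t * (w \<bullet> w)" using q by (simp add: t_def power2_eq_square)
    then show False using t \<open>\<not> w \<bullet> w \<le> 0\<close> by simp
  qed
  then have "w = 0" by (metis inner_eq_zero_iff inner_ge_zero order_antisym)
  then show thesis using that[of x c] x by (simp add: w_def)
qed

text \<open>Induction on the dimension: split off an eigenvector x and continue in the orthogonal
  complement of x within S, which is invariant because A is symmetric. Invariant subspaces, rather
  than the whole space, make the induction hypothesis fit that complement.\<close>

lemma symmetric_orthonormal_eigenbasis_subspace:
  fixes A :: "real^'n^'n"
  assumes sym: "transpose A = A" and "subspace S" "\<And>x. x \<in> S \<Longrightarrow> A *v x \<in> S"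
  shows "\<exists>E. E \<subseteq> S \<and> finite E \<and> pairwise orthogonal E \<and>
    (\<forall>v\<in>E. norm v = 1 \<and> (\<exists>c. A *v v = c *\<^sub>R v)) \<and> S \<subseteq> span E"
  using assms(2,3)
proof (induction "dim S" arbitrary: S rule: less_induct)
  case less
  show ?case
  proof (cases "S = {0}")
    case True
    then show ?thesis by (intro exI[of _ "{}"]) simp
  next
    case False
    obtain x c where x: "x \<in> S" "norm x = 1" "A *v x = c *\<^sub>R x"
      using symmetric_eigenvector[OF sym less.prems(1) False less.prems(2)] by blast
    have x1: "x \<bullet> x = 1" using x by (simp add: dot_square_norm)
    define T where "T = S \<inter> {y. orthogonal x y}"
    have T: "subspace T"
      unfolding T_def using less.prems(1) subspace_orthogonal_to_vector by (rule subspace_inter)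
    have "x \<notin> T" using x1 by (auto simp: T_def orthogonal_def)
    then have "T \<subset> S" using x by (auto simp: T_def)
    then have "dim T < dim S"
      using T less.prems(1) by (metis dim_psubset span_eq_iff)
    moreover have "A *v y \<in> T" if "y \<in> T" for y
    proof -
      have "x \<bullet> (A *v y) = (A *v x) \<bullet> y" by (simp add: inner_matrix_left sym del: transpose_matrix_vector)
      then show ?thesis using that less.prems(2) x by (auto simp: T_def orthogonal_def)
    qed
    ultimately obtain E where E: "E \<subseteq> T" "finite E" "pairwise orthogonal E"
      "\<forall>v\<in>E. norm v = 1 \<and> (\<exists>c. A *v v = c *\<^sub>R v)" "T \<subseteq> span E"
      using less.hyps[OF _ T] by blast
    have "S \<subseteq> span (insert x E)"
    proof
      fix s assume s: "s \<in> S"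
      have "s - (x \<bullet> s) *\<^sub>R x \<in> T"
        using s x x1 less.prems(1)
        by (auto simp: T_def orthogonal_def inner_diff_right subspace_diff subspace_scale)
      then have "s - (x \<bullet> s) *\<^sub>R x \<in> span (insert x E)"
        using E(5) span_mono[of E "insert x E"] by auto
      moreover have "(x \<bullet> s) *\<^sub>R x \<in> span (insert x E)"
        by (simp add: span_base span_scale)
      ultimately show "s \<in> span (insert x E)" using span_add by fastforce
    qed
    moreover have "pairwise orthogonal (insert x E)"
      using E(1,3) by (auto simp: pairwise_insert T_def orthogonal_commute)
    ultimately show ?thesis
      using E x by (intro exI[of _ "insert x E"]) (auto simp: T_def)
  qed
qed

lemma symmetric_orthonormal_eigenbasis:
  fixes A :: "real^'n^'n"
  assumes "transpose A = A"
  obtains E c where "finite E" "\<forall>u\<in>E. \<forall>v\<in>E. u \<bullet> v = (if u = v then 1 else 0)"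
    "\<forall>v\<in>E. A *v v = c v *\<^sub>R v" "span E = UNIV"
proof -
  obtain E where E: "finite E" "pairwise orthogonal E"
    "\<forall>v\<in>E. norm v = 1 \<and> (\<exists>c. A *v v = c *\<^sub>R v)" "UNIV \<subseteq> span E"
    using symmetric_orthonormal_eigenbasis_subspace[OF assms subspace_UNIV] by auto
  then obtain c where "\<forall>v\<in>E. A *v v = c v *\<^sub>R v" by metis
  moreover have "u \<bullet> v = (if u = v then 1 else 0)" if "u \<in> E" "v \<in> E" for u v
    using E(2,3) that by (auto simp: pairwise_def orthogonal_def dot_square_norm)
  ultimately show thesis using E(1,4) by (intro that[of E c]) auto
qed

section \<open>Existence and uniqueness of the root\<close>

lemma psdD:
  assumes "A \<in> psd"
  shows "transpose A = A" "0 \<le> x \<bullet> (A *v x)"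
  using assms by (auto simp: psd_def)

lemma inner_symmetric: "transpose A = A \<Longrightarrow> (A *v x) \<bullet> y = x \<bullet> (A *v y)" for A :: "real^'n^'n"
  by (metis inner_matrix_left)

lemma matrix_eqI_bilinear:
  fixes A B :: "real^'n^'m"
  assumes "\<And>u w. u \<bullet> (A *v w) = u \<bullet> (B *v w)"
  shows "A = B"
proof -
  have "A *v w = B *v w" for w
    using vector_eq_ldot[of "A *v w" "B *v w"] assms by blast
  then show ?thesis by (simp add: matrix_eq)
qed

lemma symmetricI:
  fixes A :: "real^'n^'n"
  assumes "\<And>x y. (A *v x) \<bullet> y = x \<bullet> (A *v y)"
  shows "transpose A = A"
  by (rule matrix_eqI_bilinear) (metis assms inner_matrix_left)

lemma matrix_eq_on_spanning_set:
  fixes A B :: "real^'n^'m"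
  assumes "span E = UNIV" "\<And>v. v \<in> E \<Longrightarrow> A *v v = B *v v"
  shows "A = B"
proof -
  have "A *v x = B *v x" for x
    by (rule linear_eq_on[where B = E and f = "(*v) A" and g = "(*v) B"]) (use assms in auto)
  then show ?thesis by (simp add: matrix_eq)
qed

text \<open>Keep the eigenbasis and replace each eigenvalue by its square root; the squares give
  back the eigenvalues because these are nonnegative.\<close>

lemma psd_sqrt_exists:
  fixes A :: "real^'n^'n"
  assumes "A \<in> psd"
  shows "\<exists>B\<in>psd. B ** B = A"
proof -
  obtain E c where E: "finite E" "\<forall>u\<in>E. \<forall>v\<in>E. u \<bullet> v = (if u = v then 1 else 0)"
    "\<forall>v\<in>E. A *v v = c v *\<^sub>R v" "span E = UNIV"
    using psdD(1)[OF assms] by (rule symmetric_orthonormal_eigenbasis)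
  have c: "c v \<ge> 0" if "v \<in> E" for v
    using psdD(2)[OF assms, of v] E(2) E(3) that by simp
  define f where "f x = (\<Sum>v\<in>E. (sqrt (c v) * (v \<bullet> x)) *\<^sub>R v)" for x
  have "linear f"
    unfolding f_def
    by (intro linearI) (simp_all add: inner_add_right algebra_simps sum.distrib scaleR_sum_right)
  define B where "B = matrix f"
  have B: "B *v x = f x" for x unfolding B_def by (simp add: matrix_works \<open>linear f\<close>)
  have Bv: "B *v v = sqrt (c v) *\<^sub>R v" if "v \<in> E" for v
  proof -
    have "B *v v = (\<Sum>u\<in>E. if u = v then sqrt (c v) *\<^sub>R v else 0)"
      unfolding B f_def using E(2) that by (intro sum.cong) auto
    then show ?thesis using E(1) that by simp
  qed
  have "transpose B = B"
    by (rule symmetricI) (simp add: B f_def inner_sum_left inner_sum_right inner_commute mult_ac)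
  moreover have "0 \<le> x \<bullet> (B *v x)" for x
    unfolding B f_def inner_sum_right using c
    by (intro sum_nonneg) (simp add: inner_commute mult.assoc)
  moreover have "B ** B = A"
    by (rule matrix_eq_on_spanning_set[OF E(4)])
      (use Bv E(3) c in \<open>simp add: matrix_vector_mul_assoc[symmetric] matrix_vector_mult_scaleR\<close>)
  ultimately show ?thesis by (auto simp: psd_def)
qed

text \<open>Only the difference B - C is diagonalised, and each of its eigenvalues is shown to be
  0.\<close>

lemma psd_sqrt_unique:
  fixes B C :: "real^'n^'n"
  assumes B: "B \<in> psd" and C: "C \<in> psd" and eq: "B ** B = C ** C"
  shows "B = C"
proof -
  let ?D = "B - C"
  have sym: "transpose ?D = ?D"
    using psdD(1)[OF B] psdD(1)[OF C] by (simp add: transpose_def vec_eq_iff)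
  obtain E c where E: "finite E" "\<forall>u\<in>E. \<forall>v\<in>E. u \<bullet> v = (if u = v then 1 else 0)"
    "\<forall>v\<in>E. ?D *v v = c v *\<^sub>R v" "span E = UNIV"
    using sym by (rule symmetric_orthonormal_eigenbasis)
  have D0: "?D *v v = 0" if v: "v \<in> E" for v
  proof -
    let ?b = "v \<bullet> (B *v v)" and ?c = "v \<bullet> (C *v v)"
    have v1: "v \<bullet> v = 1" using E(2) v by simp
    have Bv: "B *v v = C *v v + c v *\<^sub>R v"
      using E(3) v by (simp add: matrix_vector_mult_diff_rdistrib algebra_simps)
    have "(B *v v) \<bullet> (B *v v) = (C *v v) \<bullet> (C *v v)"
      using eq psdD(1)[OF B] psdD(1)[OF C]
      by (simp add: inner_symmetric matrix_vector_mul_assoc)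
    \<comment> \<open>The second factor is \<open>?b + ?c\<close>, a sum of nonnegative terms. If it
      vanishes, both terms do, and then c v = \<open>?b - ?c\<close> = 0.\<close>
    then have "c v * (2 * ?c + c v) = 0"
      using v1 unfolding Bv
      by (simp add: inner_add_left inner_add_right inner_commute[of "C *v v" v] distrib_left)
    moreover have "?b = ?c + c v" using v1 by (simp add: Bv inner_add_right)
    ultimately have "c v = 0"
      using psdD(2)[OF B, of v] psdD(2)[OF C, of v] by auto
    then show ?thesis using E(3) v by simp
  qed
  have "?D = 0"
    by (rule matrix_eq_on_spanning_set[OF E(4)]) (use D0 in simp)
  then show ?thesis by simp
qed

lemma msqrt:
  assumes "A \<in> psd"
  shows msqrt_psd: "msqrt A \<in> psd" and msqrt_square: "msqrt A ** msqrt A = A"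
proof -
  have "\<exists>!B. B \<in> psd \<and> B ** B = A"
    using psd_sqrt_exists[OF assms] psd_sqrt_unique by auto
  from theI'[OF this] show "msqrt A \<in> psd" "msqrt A ** msqrt A = A"
    unfolding msqrt_def by auto
qed

section \<open>Frobenius norm, contractions and resolvents\<close>

text \<open>The inner product of matrices as vectors of rows is the Frobenius one, so
  \<open>norm\<close> of a matrix is its Frobenius norm throughout.\<close>

lemma inner_matrix_trace: "M \<bullet> N = trace (M ** transpose N)" for M N :: "real^'n^'m"
  by (simp add: inner_vec_def trace_def matrix_matrix_mult_def transpose_def)

lemma norm_matrix_square: "(norm M)\<^sup>2 = trace (M ** transpose M)" for M :: "real^'n^'m"
  by (simp add: inner_matrix_trace[symmetric] dot_square_norm)

lemma trace_scaleR: "trace (c *\<^sub>R A) = c * trace A" for A :: "real^'n^'n"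
  by (simp add: trace_def sum_distrib_left)

lemma norm_transpose: "norm (transpose M) = norm M" for M :: "real^'n^'n"
proof -
  have "(norm (transpose M))\<^sup>2 = (norm M)\<^sup>2"
    by (simp add: norm_matrix_square trace_mul_sym[of "transpose M"])
  then show ?thesis by simp
qed

lemma norm_mat_1: "norm (mat 1 :: real^'n^'n) = sqrt (real CARD('n))"
proof -
  have "(norm (mat 1 :: real^'n^'n))\<^sup>2 = real CARD('n)"
    by (simp add: norm_matrix_square trace_I)
  then show ?thesis by (metis norm_ge_zero real_sqrt_unique)
qed

text \<open>Operator norm at most one. The Frobenius norm cannot express this: already the identity
  has norm sqrt n.\<close>

definition contraction :: "real^'n^'m \<Rightarrow> bool" where
  "contraction C \<longleftrightarrow> (\<forall>x. norm (C *v x) \<le> norm x)"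

text \<open>With y = C^T x, |y|^2 = <C y, x> \<le> |y| |x|, and |y| cancels.\<close>

lemma contraction_transpose:
  fixes C :: "real^'n^'m"
  assumes "contraction C"
  shows "contraction (transpose C)"
  unfolding contraction_def
proof
  fix x
  let ?y = "transpose C *v x"
  have "(norm ?y)\<^sup>2 = (C *v ?y) \<bullet> x"
    by (simp add: inner_matrix_left dot_square_norm)
  also have "\<dots> \<le> norm (C *v ?y) * norm x" by (rule norm_cauchy_schwarz)
  also have "\<dots> \<le> norm ?y * norm x"
    using assms by (intro mult_right_mono) (auto simp: contraction_def)
  finally show "norm ?y \<le> norm x"
    by (cases "?y = 0") (simp_all add: power2_eq_square)
qed

lemma contraction_mult: "contraction C \<Longrightarrow> contraction D \<Longrightarrow> contraction (C ** D)"
  unfolding contraction_def by (metis matrix_vector_mul_assoc order_trans)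

text \<open>C acts separately on the columns of M, and the squared Frobenius norm sums the squared
  column norms. The transpose enters because \<open>$\<close> selects rows.\<close>

lemma norm_contraction_mult_left:
  fixes C M :: "real^'n^'n"
  assumes "contraction C"
  shows "norm (C ** M) \<le> norm M"
proof -
  have *: "transpose (C ** M) $ j = C *v (transpose M $ j)" for j
    by (simp add: vec_eq_iff transpose_def matrix_matrix_mult_def matrix_vector_mult_def)
  have "norm (transpose (C ** M)) \<le> norm (transpose M)"
    unfolding norm_vec_def[where 'b = 'n and 'a = "real^'n"] *
    using assms by (intro L2_set_mono) (auto simp: contraction_def)
  then show ?thesis by (simp add: norm_transpose)
qed

lemma norm_contraction_mult_right:
  fixes C M :: "real^'n^'n"
  assumes "contraction C"
  shows "norm (M ** C) \<le> norm M"
  using norm_contraction_mult_left[OF contraction_transpose[OF assms], of "transpose M"]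
  by (simp add: matrix_transpose_mul[symmetric] norm_transpose)

lemma matrix_add_rdistrib: "(B + C) ** A = B ** A + C ** A" for A :: "real^'n^'m"
  by (vector matrix_matrix_mult_def sum.distrib distrib_right)

lemma matrix_diff_ldistrib: "A ** (B - C) = A ** B - A ** C" for A :: "real^'n^'m"
  by (vector matrix_matrix_mult_def sum_subtractf right_diff_distrib)

lemma matrix_diff_rdistrib: "(B - C) ** A = B ** A - C ** A" for A :: "real^'n^'m"
  by (vector matrix_matrix_mult_def sum_subtractf left_diff_distrib)

lemma transpose_add: "transpose (A + B) = transpose A + transpose B"
  by (simp add: transpose_def vec_eq_iff)

lemma transpose_diff: "transpose (A - B) = transpose A - transpose B"
  by (simp add: transpose_def vec_eq_iff)

section \<open>Inverses and resolvents\<close>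

lemma symmetric_inverse:
  fixes A J :: "real^'n^'n"
  assumes "transpose A = A" "A ** J = mat 1"
  shows "transpose J = J"
proof -
  have "transpose J ** A = mat 1"
    using assms by (metis matrix_transpose_mul transpose_mat)
  then show ?thesis
    by (metis assms(2) matrix_mul_assoc matrix_mul_lid matrix_mul_rid)
qed

lemma psd_add_scaleR_mat:
  assumes "P \<in> psd" "0 \<le> e"
  shows "P + e *\<^sub>R mat 1 \<in> psd"
  using assms by (auto simp: psd_def transpose_add transpose_scalar matrix_vector_mult_add_rdistrib
      scaleR_matrix_vector_assoc[symmetric] inner_add_right)

text \<open>J = (P + e)^-1 stands in for the inverse of a possibly singular P; the terms
  \<open>e *\<^sub>R J\<close> measure the error of that replacement. P J is a contraction because
  |P x| \<le> |(P + e) x|.\<close>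

lemma psd_resolvent:
  fixes P :: "real^'n^'n"
  assumes P: "P \<in> psd" and e: "0 < e"
  obtains J where "transpose J = J" "(P + e *\<^sub>R mat 1) ** J = mat 1" "J ** (P + e *\<^sub>R mat 1) = mat 1"
    "P ** J = mat 1 - e *\<^sub>R J" "J ** P = mat 1 - e *\<^sub>R J" "contraction (P ** J)"
proof -
  let ?Q = "P + e *\<^sub>R mat 1"
  have Qv: "?Q *v x = P *v x + e *\<^sub>R x" for x
    by (simp add: matrix_vector_mult_add_rdistrib scaleR_matrix_vector_assoc[symmetric])
  have le: "norm (P *v x) \<le> norm (?Q *v x)" and pos: "e * (x \<bullet> x) \<le> x \<bullet> (?Q *v x)" for x
  proof -
    have x: "0 \<le> x \<bullet> (P *v x)" using psdD(2)[OF P] .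
    then show "e * (x \<bullet> x) \<le> x \<bullet> (?Q *v x)" by (simp add: Qv inner_add_right)
    \<comment> \<open>Expanding the right side adds 2 e (x \<bullet> P x) + e^2 |x|^2, which is
      nonnegative.\<close>
    have "(P *v x) \<bullet> (P *v x) \<le> (?Q *v x) \<bullet> (?Q *v x)"
      using x e by (simp add: Qv inner_add_right inner_add_left inner_commute[of "P *v x" x])
    then show "norm (P *v x) \<le> norm (?Q *v x)" by (simp add: norm_le)
  qed
  have "x = 0" if "?Q *v x = 0" for x
  proof -
    have "e * (x \<bullet> x) \<le> 0" using pos[of x] that by simp
    then have "x \<bullet> x \<le> 0" using e by (simp add: mult_le_0_iff)
    then show ?thesis by (metis inner_eq_zero_iff inner_ge_zero order_antisym)
  qed
  then obtain J where J: "J ** ?Q = mat 1"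
    using matrix_left_invertible_ker by blast
  then have QJ: "?Q ** J = mat 1" by (rule matrix_left_right_inverse[THEN iffD1])
  have PJ: "P ** J = mat 1 - e *\<^sub>R J"
    using QJ by (simp add: matrix_add_rdistrib scalar_matrix_assoc[symmetric] algebra_simps)
  have JP: "J ** P = mat 1 - e *\<^sub>R J"
    using J by (simp add: matrix_add_ldistrib matrix_scalar_ac algebra_simps)
  have "contraction (P ** J)"
    unfolding contraction_def
  proof
    fix x
    have "norm (P *v (J *v x)) \<le> norm (?Q *v (J *v x))" by (rule le)
    then show "norm ((P ** J) *v x) \<le> norm x" by (simp add: matrix_vector_mul_assoc QJ)
  qed
  moreover have "transpose J = J"
    by (rule symmetric_inverse[OF psdD(1)[OF psd_add_scaleR_mat[OF P less_imp_le[OF e]]] QJ])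
  ultimately show thesis using QJ J PJ JP by (intro that)
qed

lemma outer_square_psd: "X ** transpose X \<in> psd" for X :: "real^'n^'n"
  using inner_matrix_left[of "transpose X", symmetric]
  by (auto simp: psd_def matrix_transpose_mul matrix_vector_mul_assoc[symmetric]
      simp del: transpose_matrix_vector)

section \<open>Extremal cross-covariances\<close>

text \<open>X X^T = R B R for the roots R and S of A and B, so P = (X X^T)^(1/2) is the positive
  factor in a polar decomposition X = P W.\<close>

lemma msqrt_conjugate:
  fixes A B :: "real^'n^'n"
  assumes "A \<in> psd" "B \<in> psd"
  defines "X \<equiv> msqrt A ** msqrt B" and "P \<equiv> msqrt (msqrt A ** B ** msqrt A)"
  shows "P \<in> psd" "X ** transpose X = P ** P" "transpose X = msqrt B ** msqrt A"
proof -
  have R: "transpose (msqrt A) = msqrt A" and S: "transpose (msqrt B) = msqrt B"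
    using assms by (auto intro!: psdD(1) msqrt_psd)
  show XT: "transpose X = msqrt B ** msqrt A"
    by (simp add: X_def matrix_transpose_mul R S)
  have "X ** transpose X = msqrt A ** (msqrt B ** msqrt B) ** msqrt A"
    unfolding XT by (simp add: X_def matrix_mul_assoc)
  then have XX: "X ** transpose X = msqrt A ** B ** msqrt A"
    using assms by (simp add: msqrt_square)
  then have "msqrt A ** B ** msqrt A \<in> psd" using outer_square_psd[of X] by simp
  then show "P \<in> psd" "X ** transpose X = P ** P"
    by (simp_all add: P_def msqrt_psd msqrt_square XX)
qed

text \<open>\<open>k\<close> stands for E<x,y> and \<open>young\<close> for the averaged Young
  inequality. This separates the probabilistic input from the optimisation over dual pairs L, L',
  which is pure matrix algebra.\<close>

lemma trace_cross_covariance_le: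
  fixes A B :: "real^'n^'n"
  assumes A: "A \<in> psd" and B: "B \<in> psd"
    and young: "\<And>L L' :: real^'n^'n. transpose L ** L' = mat 1 \<Longrightarrow>
      2 * k \<le> (norm (L ** msqrt A))\<^sup>2 + (norm (L' ** msqrt B))\<^sup>2"
  shows "k \<le> trace (msqrt (msqrt A ** B ** msqrt A))"
proof -
  define R where "R = msqrt A"
  define S where "S = msqrt B"
  define X where "X = R ** S"
  define P where "P = msqrt (R ** B ** R)"
  have R: "R \<in> psd" using A by (simp add: R_def msqrt_psd)
  have P: "P \<in> psd" and XX: "X ** transpose X = P ** P"
    using msqrt_conjugate[OF A B] by (simp_all add: P_def X_def R_def S_def)
  define T where "T = msqrt P"
  have T: "T \<in> psd" "T ** T = P" using P by (simp_all add: T_def msqrt_psd msqrt_square)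
  have Tn: "(norm T)\<^sup>2 = trace P" using T psdD(1)[OF T(1)] by (simp add: norm_matrix_square)
  \<comment> \<open>The shift d makes H invertible even when P is singular. It enters through |H|^2
    = tr P + d n, which bounds the first Young term; the second is bounded by tr P in the limit of
    small e.\<close>
  have bound: "2 * k \<le> 2 * trace P + d * real CARD('n)" if d: "d > 0" for d
  proof -
    obtain J where J: "transpose J = J" "(P + d *\<^sub>R mat 1) ** J = mat 1" "J ** (P + d *\<^sub>R mat 1) = mat 1"
      using psd_resolvent[OF P d] .
    have Pd: "P + d *\<^sub>R mat 1 \<in> psd" using P d by (simp add: psd_add_scaleR_mat)
    define H where "H = msqrt (P + d *\<^sub>R mat 1)"
    have H: "H \<in> psd" "H ** H = P + d *\<^sub>R mat 1"
      using Pd by (simp_all add: H_def msqrt_psd msqrt_square)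
    \<comment> \<open>\<open>K\<close> is the inverse of \<open>H\<close>, since H (H J) = (P + d) J
      = I.\<close>
    define K where "K = H ** J"
    have HK: "H ** K = mat 1" using J H(2) by (simp add: K_def matrix_mul_assoc)
    have Ks: "transpose K = K" using symmetric_inverse[OF psdD(1)[OF H(1)] HK] .
    have Hn: "(norm H)\<^sup>2 = trace P + d * real CARD('n)"
      using H(2) psdD(1)[OF H(1)] by (simp add: norm_matrix_square trace_add trace_scaleR trace_I)
    \<comment> \<open>T T = P lies below H H = P + d in the Loewner order; y = H^-1 x turns |T y|
      \<le> |H y| into the contraction bound.\<close>
    have TK: "contraction (T ** K)"
      unfolding contraction_def
    proof
      fix x
      define y where "y = K *v x"
      have Hy: "H *v y = x" by (simp add: y_def matrix_vector_mul_assoc HK)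
      have "(T *v y) \<bullet> (T *v y) = y \<bullet> (P *v y)"
        using psdD(1)[OF T(1)] by (simp add: inner_symmetric matrix_vector_mul_assoc T(2))
      also have "\<dots> \<le> y \<bullet> ((P + d *\<^sub>R mat 1) *v y)"
        using d by (simp add: matrix_vector_mult_add_rdistrib scaleR_matrix_vector_assoc[symmetric] inner_add_right)
      also have "\<dots> = (H *v y) \<bullet> (H *v y)"
        using psdD(1)[OF H(1)] by (simp add: inner_symmetric matrix_vector_mul_assoc H(2))
      finally show "norm ((T ** K) *v x) \<le> norm x"
        by (simp add: norm_le matrix_vector_mul_assoc[symmetric] y_def[symmetric] Hy)
    qed
    \<comment> \<open>Because X X^T = P P, the norm does not change when X is replaced by P = T T.
      Since K T is a contraction, at most |T|^2 = tr P remains.\<close>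
    have "(norm (K ** X))\<^sup>2 = trace (K ** (X ** transpose X) ** K)"
      by (simp add: norm_matrix_square matrix_transpose_mul Ks matrix_mul_assoc)
    also have "\<dots> = (norm (K ** T ** T))\<^sup>2"
      using psdD(1)[OF P] by (simp add: norm_matrix_square matrix_transpose_mul Ks XX matrix_mul_assoc[symmetric] T(2))
    also have "\<dots> \<le> (norm T)\<^sup>2"
    proof -
      have "K ** T = transpose (T ** K)" by (simp add: matrix_transpose_mul Ks psdD(1)[OF T(1)])
      then have "contraction (K ** T)" using contraction_transpose[OF TK] by simp
      then show ?thesis by (intro power_mono norm_contraction_mult_left) auto
    qed
    finally have KX: "(norm (K ** X))\<^sup>2 \<le> trace P" by (simp add: Tn)
    \<comment> \<open>G = (R + e)^-1 makes L = H G and L' = K (R + e) a dual pair. Then L R = H (G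
      R) has norm at most |H|, and L' S differs from K X by e K S.\<close>
    have step: "2 * k \<le> (norm H)\<^sup>2 + (norm (K ** X + e *\<^sub>R (K ** S)))\<^sup>2" if e: "e > 0" for e
    proof -
      obtain G where G: "transpose G = G" "(R + e *\<^sub>R mat 1) ** G = mat 1" "G ** (R + e *\<^sub>R mat 1) = mat 1"
        "contraction (R ** G)" using psd_resolvent[OF R e] .
      have GR: "contraction (G ** R)"
        using contraction_transpose[OF G(4)] by (simp add: matrix_transpose_mul G(1) psdD(1)[OF R])
      have "transpose (H ** G) ** (K ** (R + e *\<^sub>R mat 1)) = G ** (H ** K) ** (R + e *\<^sub>R mat 1)"
        by (simp add: matrix_transpose_mul G(1) psdD(1)[OF H(1)] matrix_mul_assoc)
      then have "transpose (H ** G) ** (K ** (R + e *\<^sub>R mat 1)) = mat 1" by (simp add: HK G(3))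
      note young = young[OF this, folded R_def S_def]
      have "norm (H ** G ** R) \<le> norm H"
        unfolding matrix_mul_assoc[symmetric] using GR by (rule norm_contraction_mult_right)
      then have "(norm (H ** G ** R))\<^sup>2 \<le> (norm H)\<^sup>2" by (simp add: power_mono)
      moreover have *: "K ** (R + e *\<^sub>R mat 1) ** S = K ** X + e *\<^sub>R (K ** S)"
        by (simp add: X_def matrix_add_ldistrib matrix_add_rdistrib matrix_scalar_ac scalar_matrix_assoc[symmetric] matrix_mul_assoc)
      ultimately show ?thesis using young unfolding * by linarith
    qed
    \<comment> \<open>First e tends to 0 while d, and with it H and K, stays fixed; the limit in d
      comes afterwards.\<close>
    have "((\<lambda>e. (norm H)\<^sup>2 + (norm (K ** X + e *\<^sub>R (K ** S)))\<^sup>2) \<longlongrightarrow>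
        (norm H)\<^sup>2 + (norm (K ** X + 0 *\<^sub>R (K ** S)))\<^sup>2) (at_right 0)"
      by (intro tendsto_intros)
    then have "2 * k \<le> (norm H)\<^sup>2 + (norm (K ** X + 0 *\<^sub>R (K ** S)))\<^sup>2"
      by (rule tendsto_lowerbound) (auto simp: eventually_at_right_less step intro: eventually_mono[OF eventually_at_right_less])
    then show ?thesis using KX Hn by simp
  qed
  have "((\<lambda>d. 2 * trace P + d * real CARD('n)) \<longlongrightarrow> 2 * trace P + 0 * real CARD('n)) (at_right 0)"
    by (intro tendsto_intros)
  then have "2 * k \<le> 2 * trace P + 0 * real CARD('n)"
    by (rule tendsto_lowerbound) (auto intro: eventually_mono[OF eventually_at_right_less] bound)
  then show ?thesis by (simp add: P_def R_def)
qed

text \<open>The error has two parts: e tr (J P) \<le> e n from regularising P, and e tr (S W^T G R)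
  \<le> e |S| sqrt n from regularising R. The first conclusion leaves room for noise that raises the
  covariance to exactly B.\<close>

lemma near_optimal_matrix:
  fixes A B :: "real^'n^'n"
  assumes A: "A \<in> psd" and B: "B \<in> psd" and e: "0 < e"
  obtains M where "B - M ** A ** transpose M \<in> psd"
    "trace (msqrt (msqrt A ** B ** msqrt A)) - e * (real CARD('n) + norm (msqrt B) * sqrt (real CARD('n))) \<le> M \<bullet> A"
proof -
  define R where "R = msqrt A"
  define S where "S = msqrt B"
  define X where "X = R ** S"
  define P where "P = msqrt (R ** B ** R)"
  have R: "R \<in> psd" "R ** R = A" and S: "S \<in> psd" "S ** S = B"
    using A B by (simp_all add: R_def S_def msqrt_psd msqrt_square)
  have P: "P \<in> psd" and XX: "X ** transpose X = P ** P" and XT: "transpose X = S ** R"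
    using msqrt_conjugate[OF A B] by (simp_all add: P_def X_def R_def S_def)
  obtain J where J: "transpose J = J" "J ** P = mat 1 - e *\<^sub>R J" "contraction (P ** J)"
    using psd_resolvent[OF P e] .
  obtain G where G: "transpose G = G" "R ** G = mat 1 - e *\<^sub>R G" "G ** R = mat 1 - e *\<^sub>R G" "contraction (R ** G)"
    using psd_resolvent[OF R(1) e] .
  note sym = psdD(1)[OF R(1)] psdD(1)[OF S(1)] psdD(1)[OF P] J(1) G(1)
  have JP: "contraction (J ** P)"
    using contraction_transpose[OF J(3)] by (simp add: matrix_transpose_mul sym)
  \<comment> \<open>For e = 0 and invertible P this would be the orthogonal polar factor P^-1 X. The
    regularised W is still a contraction, because W W^T = (P J)^T (P J).\<close>
  define W where "W = J ** X"
  have WT: "transpose W = transpose X ** J" by (simp add: W_def matrix_transpose_mul sym)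
  have "contraction (transpose W)"
    unfolding contraction_def
  proof
    fix x
    have "(transpose W *v x) \<bullet> (transpose W *v x) = x \<bullet> ((W ** transpose W) *v x)"
      by (metis inner_matrix_left matrix_vector_mul_assoc transpose_transpose)
    also have "W ** transpose W = J ** (X ** transpose X) ** J"
      unfolding WT by (simp add: W_def matrix_mul_assoc)
    also have "\<dots> = transpose (P ** J) ** (P ** J)"
      by (simp add: XX matrix_transpose_mul sym matrix_mul_assoc)
    also have "x \<bullet> (\<dots> *v x) = ((P ** J) *v x) \<bullet> ((P ** J) *v x)"
      by (metis inner_matrix_left matrix_vector_mul_assoc)
    finally show "norm (transpose W *v x) \<le> norm x"
      using J(3) by (simp add: contraction_def norm_eq_sqrt_inner)
  qed
  then have W: "contraction W" using contraction_transpose by fastforce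
  \<comment> \<open>For e = 0 and invertible A and B this becomes R^-1 P R^-1, the optimal map
    between centered Gaussians with covariances A and B.\<close>
  define M where "M = S ** transpose W ** G"
  have AM: "transpose M = G ** W ** S" by (simp add: M_def matrix_transpose_mul sym matrix_mul_assoc)
  have "B - M ** A ** transpose M \<in> psd"
  proof -
    \<comment> \<open>M R = S C^T, so M A M^T = S C^T C S, which lies below S S = B once C is a
      contraction.\<close>
    define C where "C = R ** G ** W"
    have C: "contraction C" unfolding C_def using G(4) W by (rule contraction_mult)
    have CT: "transpose C = transpose W ** G ** R" by (simp add: C_def matrix_transpose_mul sym matrix_mul_assoc)
    have MAM: "M ** A ** transpose M = transpose (C ** S) ** (C ** S)"
      unfolding AM R(2)[symmetric] matrix_transpose_mul CT by (simp add: M_def C_def sym matrix_mul_assoc)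
    have "0 \<le> x \<bullet> ((B - M ** A ** transpose M) *v x)" for x
    proof -
      have "x \<bullet> ((M ** A ** transpose M) *v x) = (C *v (S *v x)) \<bullet> (C *v (S *v x))"
        unfolding MAM by (metis inner_matrix_left matrix_vector_mul_assoc)
      also have "\<dots> \<le> (S *v x) \<bullet> (S *v x)"
        using C by (simp add: contraction_def norm_le[symmetric])
      also have "\<dots> = x \<bullet> (B *v x)"
        by (simp add: inner_symmetric sym matrix_vector_mul_assoc S(2))
      finally show ?thesis by (simp add: matrix_vector_mult_diff_rdistrib inner_diff_right)
    qed
    then show ?thesis
      by (simp add: psd_def transpose_diff psdD(1)[OF B] MAM matrix_transpose_mul)
  qed
  moreover have "trace P - e * (real CARD('n) + norm S * sqrt (real CARD('n))) \<le> M \<bullet> A"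
  proof -
    \<comment> \<open>Substituting G R = I - e G, then W^T = X^T J, cyclicity of the trace and X X^T
      = P P leave tr P minus the two errors.\<close>
    have "M \<bullet> A = trace (S ** transpose W ** (G ** R) ** R)"
      using psdD(1)[OF A] by (simp add: inner_matrix_trace M_def R(2)[symmetric] matrix_mul_assoc)
    also have "\<dots> = trace (S ** transpose W ** R) - e * trace (S ** transpose W ** G ** R)"
      unfolding G(3)
      by (simp add: matrix_diff_ldistrib matrix_diff_rdistrib trace_sub matrix_scalar_ac scalar_matrix_assoc[symmetric] trace_scaleR)
    also have "trace (S ** transpose W ** R) = trace P - e * trace (J ** P)"
    proof -
      have "trace (S ** transpose W ** R) = trace (S ** transpose X ** (J ** R))"
        by (simp add: WT matrix_mul_assoc)
      also have "\<dots> = trace ((J ** R) ** (S ** transpose X))" by (rule trace_mul_sym)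
      also have "\<dots> = trace (J ** (X ** transpose X))" by (simp add: X_def matrix_mul_assoc)
      also have "\<dots> = trace ((J ** P) ** P)" by (simp add: XX matrix_mul_assoc)
      also have "(J ** P) ** P = P - e *\<^sub>R (J ** P)"
        by (subst J(2)) (simp add: matrix_diff_rdistrib scalar_matrix_assoc)
      finally have "trace (S ** transpose W ** R) = trace (P - e *\<^sub>R (J ** P))" .
      then show ?thesis by (simp add: trace_sub trace_scaleR)
    qed
    finally have eq: "M \<bullet> A = trace P - e * trace (J ** P) - e * trace (S ** transpose W ** G ** R)" .
    \<comment> \<open>A trace is an inner product with the identity, whose Frobenius norm is sqrt n;
      Cauchy-Schwarz then lets the contractions drop out.\<close>
    have "trace (J ** P) = (J ** P ** mat 1) \<bullet> mat 1" by (simp add: inner_matrix_trace)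
    also have "\<dots> \<le> norm (J ** P ** mat 1) * norm (mat 1 :: real^'n^'n)" by (rule norm_cauchy_schwarz)
    also have "\<dots> \<le> norm (mat 1 :: real^'n^'n) * norm (mat 1 :: real^'n^'n)"
      using JP by (intro mult_right_mono norm_contraction_mult_left) auto
    finally have 1: "trace (J ** P) \<le> real CARD('n)" by (simp add: norm_mat_1)
    have GR: "contraction (G ** R)"
      using contraction_transpose[OF G(4)] by (simp add: matrix_transpose_mul sym)
    have "trace (S ** transpose W ** G ** R) = (S ** (transpose W ** (G ** R))) \<bullet> mat 1"
      by (simp add: inner_matrix_trace matrix_mul_assoc)
    also have "\<dots> \<le> norm (S ** (transpose W ** (G ** R))) * norm (mat 1 :: real^'n^'n)" by (rule norm_cauchy_schwarz)
    also have "\<dots> \<le> norm S * norm (mat 1 :: real^'n^'n)"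
      using contraction_mult[OF \<open>contraction (transpose W)\<close> GR]
      by (intro mult_right_mono norm_contraction_mult_right) auto
    finally have 2: "trace (S ** transpose W ** G ** R) \<le> norm S * sqrt (real CARD('n))" by (simp add: norm_mat_1)
    show ?thesis
      unfolding eq distrib_left
      using mult_left_mono[OF 1 less_imp_le[OF e]] mult_left_mono[OF 2 less_imp_le[OF e]] by linarith
  qed
  ultimately show thesis using that by (simp add: P_def R_def S_def)
qed

section \<open>Covariances and couplings\<close>

text \<open>Cauchy-Schwarz and a b \<le> a^2 + b^2 dominate both integrands by a multiple of |X|^2 +
  |Y|^2.\<close>

lemma integrable_inner_prod:
  fixes X Y :: "'a \<Rightarrow> real^'n"
  assumes [measurable]: "X \<in> borel_measurable Q" "Y \<in> borel_measurable Q"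
    and X: "integrable Q (\<lambda>p. (norm (X p))\<^sup>2)" and Y: "integrable Q (\<lambda>p. (norm (Y p))\<^sup>2)"
  shows "integrable Q (\<lambda>p. X p \<bullet> Y p)" "integrable Q (\<lambda>p. (u \<bullet> X p) * (w \<bullet> Y p))"
proof -
  have bound: "integrable Q (\<lambda>p. c * ((norm (X p))\<^sup>2 + (norm (Y p))\<^sup>2))" for c :: real
    using X Y by simp
  have xy: "a * b \<le> a\<^sup>2 + b\<^sup>2" for a b :: real
    using sum_squares_bound[of a b] zero_le_power2[of a] zero_le_power2[of b] by linarith
  show "integrable Q (\<lambda>p. X p \<bullet> Y p)"
  proof (rule Bochner_Integration.integrable_bound[OF bound[of 1]])
    have "\<bar>x \<bullet> y\<bar> \<le> (norm x)\<^sup>2 + (norm y)\<^sup>2" for x y :: "real^'n"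
      by (rule order_trans[OF Cauchy_Schwarz_ineq2 xy])
    then show "AE p in Q. norm (X p \<bullet> Y p) \<le> norm (1 * ((norm (X p))\<^sup>2 + (norm (Y p))\<^sup>2))"
      by simp
  qed measurable
  show "integrable Q (\<lambda>p. (u \<bullet> X p) * (w \<bullet> Y p))"
  proof (rule Bochner_Integration.integrable_bound[OF bound[of "norm u * norm w"]])
    have "\<bar>(u \<bullet> x) * (w \<bullet> y)\<bar> \<le> norm u * norm w * ((norm x)\<^sup>2 + (norm y)\<^sup>2)" for x y :: "real^'n"
    proof -
      have "\<bar>(u \<bullet> x) * (w \<bullet> y)\<bar> \<le> (norm u * norm x) * (norm w * norm y)"
        unfolding abs_mult by (intro mult_mono Cauchy_Schwarz_ineq2) auto
      also have "\<dots> = norm u * norm w * (norm x * norm y)" by simp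
      also have "\<dots> \<le> norm u * norm w * ((norm x)\<^sup>2 + (norm y)\<^sup>2)"
        by (intro mult_left_mono xy) auto
      finally show ?thesis .
    qed
    then show "AE p in Q. norm ((u \<bullet> X p) * (w \<bullet> Y p)) \<le>
        norm (norm u * norm w * ((norm (X p))\<^sup>2 + (norm (Y p))\<^sup>2))"
      by (simp add: abs_mult)
  qed measurable
qed

lemma (in finite_measure) norm_square_integrable_imp_integrable:
  fixes X :: "'a \<Rightarrow> 'b::{banach, second_countable_topology}"
  assumes "X \<in> borel_measurable M" "integrable M (\<lambda>p. (norm (X p))\<^sup>2)"
  shows "integrable M X"
proof -
  have "integrable M (\<lambda>p. norm (X p))"
    by (rule square_integrable_imp_integrable) (use assms in auto)
  then show ?thesis using assms(1) by (simp add: integrable_norm_iff)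
qed

lemma centered_P2D:
  assumes "\<mu> \<in> centered_P2"
  shows "prob_space \<mu>" "sets \<mu> = sets borel" "integrable \<mu> (\<lambda>x. (norm x)\<^sup>2)" "(LINT x|\<mu>. x) = 0"
    "(\<lambda>x. x) \<in> borel_measurable \<mu>"
  using assms by (auto simp: centered_P2_def measurable_cong_sets[of \<mu> borel borel borel])

text \<open>The Frobenius norm of x x^T is |x|^2, so the finite second moment dominates.\<close>

lemma integrable_outer_product:
  assumes "\<mu> \<in> centered_P2"
  shows "integrable \<mu> (\<lambda>x. \<chi> i j. x $ i * x $ j :: real^'n^'n)"
proof (rule Bochner_Integration.integrable_bound[OF centered_P2D(3)[OF assms]])
  have "(\<lambda>x. \<chi> i j. x $ i * x $ j :: real^'n^'n) \<in> borel_measurable borel"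
    by (intro borel_measurable_continuous_onI continuous_intros)
  then show "(\<lambda>x. \<chi> i j. x $ i * x $ j :: real^'n^'n) \<in> borel_measurable \<mu>"
    using centered_P2D(2)[OF assms] by (simp add: measurable_cong_sets[of \<mu> borel borel borel])
  have "norm (\<chi> i j. x $ i * x $ j :: real^'n^'n) = (norm x)\<^sup>2" for x :: "real^'n"
  proof -
    have "(norm (\<chi> i j. x $ i * x $ j :: real^'n^'n))\<^sup>2 = ((norm x)\<^sup>2)\<^sup>2"
      unfolding dot_square_norm[symmetric]
      by (simp add: inner_vec_def power2_eq_square sum_product mult_ac)
    then show ?thesis by (rule power2_eq_imp_eq) simp_all
  qed
  then show "AE x in \<mu>. norm (\<chi> i j. x $ i * x $ j :: real^'n^'n) \<le> norm ((norm x)\<^sup>2)"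
    by simp
qed

text \<open>M \<bullet> x x^T = x \<bullet> M x, and the inner product with a fixed M passes through
  the Bochner integral.\<close>

lemma inner_Cov:
  fixes M :: "real^'n^'n"
  assumes "\<mu> \<in> centered_P2"
  shows "M \<bullet> Cov \<mu> = (LINT x|\<mu>. x \<bullet> (M *v x))"
proof -
  have "M \<bullet> Cov \<mu> = (LINT x|\<mu>. M \<bullet> (\<chi> i j. x $ i * x $ j))"
    unfolding Cov_def using integrable_outer_product[OF assms] by simp
  also have "(\<lambda>x. M \<bullet> (\<chi> i j. x $ i * x $ j)) = (\<lambda>x. x \<bullet> (M *v x))"
    by (simp add: inner_vec_def matrix_vector_mult_def sum_distrib_left mult_ac)
  finally show ?thesis .
qed

lemma bilinear_Cov:
  fixes u w :: "real^'n"
  assumes "\<mu> \<in> centered_P2"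
  shows "u \<bullet> (Cov \<mu> *v w) = (LINT x|\<mu>. (u \<bullet> x) * (w \<bullet> x))"
proof -
  \<comment> \<open>The rank-one matrix u w^T turns the bilinear form into a Frobenius inner
    product.\<close>
  define M :: "real^'n^'n" where "M = (\<chi> i j. u $ i * w $ j)"
  have "u \<bullet> (Cov \<mu> *v w) = M \<bullet> Cov \<mu>"
    by (simp add: M_def inner_vec_def matrix_vector_mult_def sum_distrib_left mult_ac)
  moreover have "x \<bullet> (M *v x) = (u \<bullet> x) * (w \<bullet> x)" for x
    unfolding M_def inner_vec_def matrix_vector_mult_def sum_product
    by (simp add: sum_distrib_left mult_ac)
  ultimately show ?thesis by (simp add: inner_Cov[OF assms])
qed

lemma Cov_psd:
  assumes "\<mu> \<in> centered_P2"
  shows "Cov \<mu> \<in> psd"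
proof -
  have "transpose (Cov \<mu>) = Cov \<mu>"
    by (rule symmetricI) (simp add: inner_commute[of "Cov \<mu> *v _"] bilinear_Cov[OF assms] mult.commute)
  then show ?thesis by (simp add: psd_def bilinear_Cov[OF assms])
qed

text \<open>Both sides are tr (L A L^T) with A the covariance; the right side has the form that
  \<open>young\<close> in \<open>trace_cross_covariance_le\<close> asks for.\<close>

lemma second_moment_linear_image:
  fixes L :: "real^'n^'n"
  assumes "\<mu> \<in> centered_P2"
  shows "(LINT x|\<mu>. (norm (L *v x))\<^sup>2) = (norm (L ** msqrt (Cov \<mu>)))\<^sup>2"
proof -
  let ?A = "Cov \<mu>"
  note A = Cov_psd[OF assms]
  have "(norm (L *v x))\<^sup>2 = x \<bullet> ((transpose L ** L) *v x)" for x
    by (metis dot_square_norm inner_matrix_left matrix_vector_mul_assoc)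
  then have "(LINT x|\<mu>. (norm (L *v x))\<^sup>2) = (transpose L ** L) \<bullet> ?A"
    by (simp add: inner_Cov[OF assms])
  also have "\<dots> = trace (transpose L ** (L ** ?A))"
    by (simp add: inner_matrix_trace psdD(1)[OF A] matrix_mul_assoc)
  also have "\<dots> = trace (L ** (msqrt ?A ** msqrt ?A) ** transpose L)"
    by (simp add: trace_mul_sym[of "transpose L"] msqrt_square[OF A])
  also have "\<dots> = (norm (L ** msqrt ?A))\<^sup>2"
    by (simp add: norm_matrix_square matrix_transpose_mul psdD(1)[OF msqrt_psd[OF A]] matrix_mul_assoc)
  finally show ?thesis .
qed

lemma trace_Cov: "\<mu> \<in> centered_P2 \<Longrightarrow> trace (Cov \<mu>) = (LINT x|\<mu>. (norm x)\<^sup>2)"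
  using inner_Cov[of \<mu> "mat 1"] psdD(1)[OF Cov_psd, of \<mu>]
  by (simp add: inner_matrix_trace dot_square_norm)

lemma integrable_linear_image_square:
  fixes L :: "real^'n^'m"
  assumes [measurable]: "X \<in> borel_measurable Q" and X: "integrable Q (\<lambda>p. (norm (X p))\<^sup>2)"
  shows "integrable Q (\<lambda>p. (norm (L *v X p))\<^sup>2)" "(\<lambda>p. L *v X p) \<in> borel_measurable Q"
proof -
  obtain K where K: "\<And>x. norm (L *v x) \<le> norm x * K"
    using bounded_linear.bounded[OF matrix_vector_mul_bounded_linear[of L]] by blast
  have m: "(\<lambda>x. L *v x) \<in> borel_measurable borel"
    by (intro borel_measurable_continuous_onI continuous_intros)
  show *[measurable]: "(\<lambda>p. L *v X p) \<in> borel_measurable Q"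
    using measurable_compose[OF assms(1) m] .
  have "integrable Q (\<lambda>p. K\<^sup>2 * (norm (X p))\<^sup>2)" using X by simp
  then show "integrable Q (\<lambda>p. (norm (L *v X p))\<^sup>2)"
  proof (rule Bochner_Integration.integrable_bound)
    have "(norm (L *v x))\<^sup>2 \<le> K\<^sup>2 * (norm x)\<^sup>2" for x
      using power_mono[OF K, of x 2] by (simp add: power_mult_distrib mult.commute)
    then show "AE p in Q. norm ((norm (L *v X p))\<^sup>2) \<le> norm (K\<^sup>2 * (norm (X p))\<^sup>2)" by simp
  qed measurable
qed

section \<open>Couplings and their cost\<close>

lemma couplingD:
  assumes \<pi>: "\<pi> \<in> couplings \<mu> \<nu>"
  shows coupling_fst: "fst \<in> borel_measurable \<pi>" and coupling_snd: "snd \<in> borel_measurable \<pi>"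
    and coupling_integral_fst: "\<And>f :: real^'n \<Rightarrow> real. f \<in> borel_measurable borel \<Longrightarrow>
      (LINT p|\<pi>. f (fst p)) = (LINT x|\<mu>. f x)"
    and coupling_integral_snd: "\<And>f :: real^'n \<Rightarrow> real. f \<in> borel_measurable borel \<Longrightarrow>
      (LINT p|\<pi>. f (snd p)) = (LINT x|\<nu>. f x)"
    and coupling_integrable_fst: "\<And>f :: real^'n \<Rightarrow> real. f \<in> borel_measurable borel \<Longrightarrow>
      integrable \<mu> f \<Longrightarrow> integrable \<pi> (\<lambda>p. f (fst p))"
    and coupling_integrable_snd: "\<And>f :: real^'n \<Rightarrow> real. f \<in> borel_measurable borel \<Longrightarrow>
      integrable \<nu> f \<Longrightarrow> integrable \<pi> (\<lambda>p. f (snd p))"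
proof -
  have s: "sets \<pi> = sets borel" and d: "distr \<pi> borel fst = \<mu>" "distr \<pi> borel snd = \<nu>"
    using \<pi> by (auto simp: couplings_def)
  show f: "fst \<in> borel_measurable \<pi>" and g: "snd \<in> borel_measurable \<pi>"
    unfolding measurable_cong_sets[OF s refl]
    by (intro borel_measurable_continuous_onI continuous_intros)+
  fix h :: "real^'n \<Rightarrow> real" assume h: "h \<in> borel_measurable borel"
  show "(LINT p|\<pi>. h (fst p)) = (LINT x|\<mu>. h x)" "(LINT p|\<pi>. h (snd p)) = (LINT x|\<nu>. h x)"
    unfolding d[symmetric] using h f g by (simp_all add: integral_distr)
  show "integrable \<mu> h \<Longrightarrow> integrable \<pi> (\<lambda>p. h (fst p))" "integrable \<nu> h \<Longrightarrow> integrable \<pi> (\<lambda>p. h (snd p))"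
    unfolding d[symmetric] using h f g by (simp_all add: integrable_distr_eq)
qed

lemma coupling_square_integrable:
  assumes "\<mu> \<in> centered_P2" "\<nu> \<in> centered_P2" "\<pi> \<in> couplings \<mu> \<nu>"
  shows "integrable \<pi> (\<lambda>p. (norm (fst p))\<^sup>2)" "integrable \<pi> (\<lambda>p. (norm (snd p))\<^sup>2)"
  using assms(1,2) coupling_integrable_fst[OF assms(3), of "\<lambda>x. (norm x)\<^sup>2"]
    coupling_integrable_snd[OF assms(3), of "\<lambda>x. (norm x)\<^sup>2"]
  by (auto simp: centered_P2D)

text \<open>Expanding the square leaves the second moments of the marginals, common to all
  couplings, so only E<x,y> varies.\<close>

lemma coupling_cost:
  assumes \<mu>: "\<mu> \<in> centered_P2" and \<nu>: "\<nu> \<in> centered_P2" and \<pi>: "\<pi> \<in> couplings \<mu> \<nu>"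
  shows "(LINT (x, y)|\<pi>. (norm (x - y))\<^sup>2) =
    trace (Cov \<mu>) + trace (Cov \<nu>) - 2 * (LINT p|\<pi>. fst p \<bullet> snd p)"
proof -
  note sq = coupling_square_integrable[OF assms]
  have i: "integrable \<pi> (\<lambda>p. fst p \<bullet> snd p)"
    using coupling_fst[OF \<pi>] coupling_snd[OF \<pi>] sq by (rule integrable_inner_prod(1))
  have "(LINT (x, y)|\<pi>. (norm (x - y))\<^sup>2) =
      (LINT p|\<pi>. (norm (fst p))\<^sup>2 + (norm (snd p))\<^sup>2 - 2 * (fst p \<bullet> snd p))"
    by (simp add: case_prod_beta' dot_square_norm[symmetric] inner_diff_left inner_diff_right
        inner_commute algebra_simps)
  also have "\<dots> = (LINT p|\<pi>. (norm (fst p))\<^sup>2) + (LINT p|\<pi>. (norm (snd p))\<^sup>2) - 2 * (LINT p|\<pi>. fst p \<bullet> snd p)"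
    using sq i by simp
  finally show ?thesis
    using coupling_integral_fst[OF \<pi>, of "\<lambda>x. (norm x)\<^sup>2"] coupling_integral_snd[OF \<pi>, of "\<lambda>x. (norm x)\<^sup>2"]
    by (simp add: trace_Cov[OF \<mu>] trace_Cov[OF \<nu>])
qed

text \<open>Pointwise, L^T L' = I gives <x,y> = <L x, L' y>, and |L x - L' y|^2 \<ge> 0 gives
  Young's inequality. Its integral supplies the hypothesis \<open>young\<close>.\<close>

lemma coupling_inner_le:
  assumes \<mu>: "\<mu> \<in> centered_P2" and \<nu>: "\<nu> \<in> centered_P2" and \<pi>: "\<pi> \<in> couplings \<mu> \<nu>"
  shows "(LINT p|\<pi>. fst p \<bullet> snd p) \<le>
    trace (msqrt (msqrt (Cov \<mu>) ** Cov \<nu> ** msqrt (Cov \<mu>)))"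
proof (rule trace_cross_covariance_le[OF Cov_psd[OF \<mu>] Cov_psd[OF \<nu>]])
  fix L L' :: "real^'a^'a"
  assume L: "transpose L ** L' = mat 1"
  note m = coupling_fst[OF \<pi>] coupling_snd[OF \<pi>]
  note sq = coupling_square_integrable[OF assms]
  note Li = integrable_linear_image_square[OF m(1) sq(1), of L] integrable_linear_image_square[OF m(2) sq(2), of L']
  have "2 * (x \<bullet> y) \<le> (norm (L *v x))\<^sup>2 + (norm (L' *v y))\<^sup>2" for x y
  proof -
    have "x \<bullet> y = (L *v x) \<bullet> (L' *v y)"
      by (simp add: inner_matrix_left matrix_vector_mul_assoc L del: transpose_matrix_vector)
    moreover have "0 \<le> (L *v x - L' *v y) \<bullet> (L *v x - L' *v y)" by simp
    ultimately show ?thesis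
      by (simp add: dot_square_norm[symmetric] inner_diff_left inner_diff_right inner_commute)
  qed
  then have "(LINT p|\<pi>. 2 * (fst p \<bullet> snd p)) \<le> (LINT p|\<pi>. (norm (L *v fst p))\<^sup>2 + (norm (L' *v snd p))\<^sup>2)"
    using integrable_inner_prod(1)[OF m sq] Li by (intro integral_mono) auto
  also have "\<dots> = (LINT p|\<pi>. (norm (L *v fst p))\<^sup>2) + (LINT p|\<pi>. (norm (L' *v snd p))\<^sup>2)"
    using Li by simp
  also have "\<dots> = (norm (L ** msqrt (Cov \<mu>)))\<^sup>2 + (norm (L' ** msqrt (Cov \<nu>)))\<^sup>2"
  proof -
    have "(\<lambda>x. (norm (N *v x))\<^sup>2) \<in> borel_measurable borel" for N :: "real^'a^'a"
      by (intro borel_measurable_continuous_onI continuous_intros)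
    then show ?thesis
      by (simp add: coupling_integral_fst[OF \<pi>, of "\<lambda>x. (norm (L *v x))\<^sup>2"]
          coupling_integral_snd[OF \<pi>, of "\<lambda>x. (norm (L' *v x))\<^sup>2"] second_moment_linear_image \<mu> \<nu>)
  qed
  finally show "2 * (LINT p|\<pi>. fst p \<bullet> snd p) \<le> (norm (L ** msqrt (Cov \<mu>)))\<^sup>2 + (norm (L' ** msqrt (Cov \<nu>)))\<^sup>2"
    by simp
qed

section \<open>Independent noise and near-optimal couplings\<close>

text \<open>Serves twice: it shows that couplings exist, and it provides noise independent of
  x.\<close>

lemma pair_measure_coupling:
  fixes \<mu> \<nu> :: "(real^'n) measure"
  assumes \<mu>: "\<mu> \<in> centered_P2" and \<nu>: "\<nu> \<in> centered_P2"
  shows "\<mu> \<Otimes>\<^sub>M \<nu> \<in> couplings \<mu> \<nu>"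
proof -
  interpret \<mu>: prob_space \<mu> using centered_P2D[OF \<mu>] by blast
  interpret \<nu>: prob_space \<nu> using centered_P2D[OF \<nu>] by blast
  interpret pair_prob_space \<mu> \<nu> ..
  note s = centered_P2D(2)[OF \<mu>] centered_P2D(2)[OF \<nu>]
  have "distr (\<mu> \<Otimes>\<^sub>M \<nu>) borel fst = distr (\<mu> \<Otimes>\<^sub>M \<nu>) \<mu> fst"
    by (rule distr_cong) (simp_all add: s)
  also have "\<dots> = \<mu>" by (rule \<nu>.distr_pair_fst)
  finally have f: "distr (\<mu> \<Otimes>\<^sub>M \<nu>) borel fst = \<mu>" .
  have g: "distr (\<mu> \<Otimes>\<^sub>M \<nu>) borel snd = \<nu>"
  proof (rule measure_eqI)
    fix A assume "A \<in> sets (distr (\<mu> \<Otimes>\<^sub>M \<nu>) borel snd)"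
    then have A: "A \<in> sets \<nu>" by (simp add: s)
    have m: "snd \<in> measurable (\<mu> \<Otimes>\<^sub>M \<nu>) borel"
      using measurable_snd[of \<mu> \<nu>] by (simp add: measurable_cong_sets[OF refl s(2)])
    have "snd -` A \<inter> space (\<mu> \<Otimes>\<^sub>M \<nu>) = space \<mu> \<times> A"
      using sets.sets_into_space[OF A] by (auto simp: space_pair_measure)
    then show "emeasure (distr (\<mu> \<Otimes>\<^sub>M \<nu>) borel snd) A = emeasure \<nu> A"
      using A m \<nu>.emeasure_pair_measure_Times[OF sets.top[of \<mu>] A]
      by (simp add: emeasure_distr s \<mu>.emeasure_space_1)
  qed (simp add: s)
  have "sets (\<mu> \<Otimes>\<^sub>M \<nu>) = sets (borel :: ((real^'n) \<times> (real^'n)) measure)"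
    using sets_pair_measure_cong[OF s] unfolding borel_prod .
  then show ?thesis
    using f g prob_space_axioms by (simp add: couplings_def)
qed

text \<open>By Fubini, integrate over the second variable first; the inner integral vanishes because
  \<nu> is centered.\<close>

lemma pair_measure_uncorrelated:
  fixes \<mu> \<nu> :: "(real^'n) measure"
  assumes \<mu>: "\<mu> \<in> centered_P2" and \<nu>: "\<nu> \<in> centered_P2"
  shows "(LINT p|(\<mu> \<Otimes>\<^sub>M \<nu>). (u \<bullet> fst p) * (w \<bullet> snd p)) = 0"
proof -
  interpret \<mu>: prob_space \<mu> using centered_P2D[OF \<mu>] by blast
  interpret \<nu>: prob_space \<nu> using centered_P2D[OF \<nu>] by blast
  interpret pair_prob_space \<mu> \<nu> ..
  note c = pair_measure_coupling[OF assms]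
  have "integrable \<nu> (\<lambda>x. x)"
    using centered_P2D(5,3)[OF \<nu>] by (rule \<nu>.norm_square_integrable_imp_integrable)
  then have 0: "(LINT z|\<nu>. (u \<bullet> x) * (w \<bullet> z)) = 0" for x
    using centered_P2D(4)[OF \<nu>] by simp
  have "integrable (\<mu> \<Otimes>\<^sub>M \<nu>) (\<lambda>p. (u \<bullet> fst p) * (w \<bullet> snd p))"
    using coupling_fst[OF c] coupling_snd[OF c] coupling_square_integrable[OF assms c]
    by (rule integrable_inner_prod(2))
  then have "integrable (\<mu> \<Otimes>\<^sub>M \<nu>) (\<lambda>(x, z). (u \<bullet> x) * (w \<bullet> z))" by (simp add: case_prod_beta')
  from integral_fst[OF this, unfolded 0] show ?thesis by (simp add: case_prod_beta')
qed

text \<open>The uniform law on the 2n points \<plusminus> sqrt n e_i. The signs center it, and the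
  factor sqrt n offsets the probability 1/n of each axis. Finite support makes all integrability
  trivial.\<close>

lemma isotropic_measure_exists:
  obtains \<zeta> :: "(real^'n) measure" where "\<zeta> \<in> centered_P2" "Cov \<zeta> = mat 1"
proof -
  define s where "s = sqrt (real CARD('n))"
  have s: "s * s = real CARD('n)" by (simp add: s_def)
  define f :: "'n \<times> bool \<Rightarrow> real^'n" where "f = (\<lambda>(i, b). (if b then s else - s) *\<^sub>R axis i 1)"
  define p :: "('n \<times> bool) pmf" where "p = pmf_of_set UNIV"
  define \<zeta> where "\<zeta> = distr (measure_pmf p) borel f"
  have int: "(LINT x|\<zeta>. h x) = (\<Sum>i\<in>UNIV. h (s *\<^sub>R axis i 1) + h (- s *\<^sub>R axis i 1)) / (2 * real CARD('n))"
    if "h \<in> borel_measurable borel" for h :: "real^'n \<Rightarrow> real"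
  proof -
    have "(LINT x|\<zeta>. h x) = measure_pmf.expectation p (\<lambda>k. h (f k))"
      unfolding \<zeta>_def using that by (intro integral_distr) auto
    also have "\<dots> = (\<Sum>k\<in>UNIV. h (f k)) / real CARD('n \<times> bool)"
      unfolding p_def by (rule integral_pmf_of_set) auto
    also have "(\<Sum>k\<in>UNIV. h (f k)) = (\<Sum>i\<in>UNIV. \<Sum>b\<in>UNIV. h (f (i, b)))"
      by (simp add: sum.cartesian_product)
    finally show ?thesis by (simp add: f_def UNIV_bool add.commute)
  qed
  have fin: "integrable \<zeta> h" if "h \<in> borel_measurable borel" for h :: "real^'n \<Rightarrow> 'b::{banach, second_countable_topology}"
    unfolding \<zeta>_def using that
    by (subst integrable_distr_eq) (auto intro!: integrable_measure_pmf_finite)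
  have "u \<bullet> (LINT x|\<zeta>. x) = 0" for u
  proof -
    have "u \<bullet> (LINT x|\<zeta>. x) = (LINT x|\<zeta>. u \<bullet> x)" using fin[of "\<lambda>x. x"] by simp
    then show ?thesis by (simp add: int)
  qed
  then have "(LINT x|\<zeta>. x) = 0" by (metis inner_eq_zero_iff)
  then have \<zeta>: "\<zeta> \<in> centered_P2"
    using fin[of "\<lambda>x. (norm x)\<^sup>2"] measure_pmf.prob_space_distr[where f = f and M' = borel and M = p]
    by (auto simp: centered_P2_def \<zeta>_def)
  have "u \<bullet> (Cov \<zeta> *v w) = u \<bullet> (mat 1 *v w)" for u w
  proof -
    have "u \<bullet> (Cov \<zeta> *v w) = (\<Sum>i\<in>UNIV. 2 * real CARD('n) * (u $ i * w $ i)) / (2 * real CARD('n))"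
      unfolding bilinear_Cov[OF \<zeta>] by (simp add: int inner_axis s[symmetric] mult_ac)
    also have "\<dots> = u \<bullet> w"
      by (simp add: sum_distrib_left[symmetric] inner_vec_def)
    finally show ?thesis by simp
  qed
  then have "Cov \<zeta> = mat 1" by (rule matrix_eqI_bilinear)
  with \<zeta> show thesis by (rule that)
qed

text \<open>Take the joint law of x and y = M x + N z with z independent, centered and of covariance
  I. Mixed moments of x and z vanish, so M alone determines E<x,y>, while N only adds covariance to
  y.\<close>

lemma noisy_linear_image:
  fixes M N :: "real^'n^'n"
  assumes \<mu>: "\<mu> \<in> centered_P2"
  obtains \<nu> \<pi> where "\<nu> \<in> centered_P2" "\<pi> \<in> couplings \<mu> \<nu>"
    "Cov \<nu> = M ** Cov \<mu> ** transpose M + N ** transpose N"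
    "(LINT p|\<pi>. fst p \<bullet> snd p) = M \<bullet> Cov \<mu>"
proof -
  obtain \<zeta> :: "(real^'n) measure" where \<zeta>: "\<zeta> \<in> centered_P2" "Cov \<zeta> = mat 1"
    by (rule isotropic_measure_exists)
  let ?Q = "\<mu> \<Otimes>\<^sub>M \<zeta>"
  note c = pair_measure_coupling[OF \<mu> \<zeta>(1)]
  note m = coupling_fst[OF c] coupling_snd[OF c]
  note sq = coupling_square_integrable[OF \<mu> \<zeta>(1) c]
  have sym: "Cov \<mu> = transpose (Cov \<mu>)" using psdD(1)[OF Cov_psd[OF \<mu>]] by simp
  interpret Q: prob_space ?Q using c by (simp add: couplings_def)
  define Y where "Y p = M *v fst p + N *v snd p" for p
  note Mi = integrable_linear_image_square[OF m(1) sq(1), of M]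
  note Ni = integrable_linear_image_square[OF m(2) sq(2), of N]
  have Ym: "Y \<in> borel_measurable ?Q"
    unfolding Y_def using Mi(2) Ni(2) by (rule borel_measurable_add)
  have Yi: "integrable ?Q (\<lambda>p. (norm (Y p))\<^sup>2)"
  proof -
    have "(\<lambda>p. (norm (Y p))\<^sup>2) =
        (\<lambda>p. (norm (M *v fst p))\<^sup>2 + (norm (N *v snd p))\<^sup>2 + 2 * ((M *v fst p) \<bullet> (N *v snd p)))"
      by (simp add: Y_def dot_square_norm[symmetric] inner_add_left inner_add_right inner_commute add_ac)
    then show ?thesis
      using Mi Ni integrable_inner_prod(1)[OF Mi(2) Ni(2) Mi(1) Ni(1)] by simp
  qed
  define \<pi> where "\<pi> = distr ?Q borel (\<lambda>p. (fst p, Y p))"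
  define \<nu> where "\<nu> = distr ?Q borel Y"
  have pm: "(\<lambda>p. (fst p, Y p)) \<in> borel_measurable ?Q" using m(1) Ym by (rule borel_measurable_Pair)
  have fs: "fst \<in> borel_measurable borel" "snd \<in> borel_measurable borel"
    by (intro borel_measurable_continuous_onI continuous_intros)+
  \<comment> \<open>Moving M and N onto the test vector reduces every moment of Y to moments of x
    and z against fixed vectors.\<close>
  have uY: "u \<bullet> Y p = (transpose M *v u) \<bullet> fst p + (transpose N *v u) \<bullet> snd p" for u p
    by (simp add: Y_def inner_add_right inner_matrix_left del: transpose_matrix_vector)
  have i1: "integrable ?Q fst" and i2: "integrable ?Q snd"
    by (rule Q.norm_square_integrable_imp_integrable; fact m sq)+
  have lin: "(LINT p|?Q. u \<bullet> fst p) = 0" "(LINT p|?Q. u \<bullet> snd p) = 0" for u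
  proof -
    have "integrable \<mu> (\<lambda>x. x)" "integrable \<zeta> (\<lambda>x. x)"
      using finite_measure.norm_square_integrable_imp_integrable[OF prob_space.finite_measure centered_P2D(5,3)]
        centered_P2D(1) \<mu> \<zeta>(1) by blast+
    then have "(LINT x|\<mu>. u \<bullet> x) = 0" "(LINT x|\<zeta>. u \<bullet> x) = 0"
      using centered_P2D(4)[OF \<mu>] centered_P2D(4)[OF \<zeta>(1)] by simp_all
    moreover have "(LINT p|?Q. u \<bullet> fst p) = (LINT x|\<mu>. u \<bullet> x)"
      by (rule coupling_integral_fst[OF c]) simp
    moreover have "(LINT p|?Q. u \<bullet> snd p) = (LINT x|\<zeta>. u \<bullet> x)"
      by (rule coupling_integral_snd[OF c]) simp
    ultimately show "(LINT p|?Q. u \<bullet> fst p) = 0" "(LINT p|?Q. u \<bullet> snd p) = 0"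
      by (simp_all only:)
  qed
  have "u \<bullet> (LINT y|\<nu>. y) = 0" for u
  proof -
    have iY: "integrable ?Q Y" using Ym Yi by (rule Q.norm_square_integrable_imp_integrable)
    have "u \<bullet> (LINT y|\<nu>. y) = u \<bullet> (LINT p|?Q. Y p)"
      unfolding \<nu>_def using Ym by (simp add: integral_distr)
    also have "\<dots> = (LINT p|?Q. u \<bullet> Y p)" using iY by simp
    also have "\<dots> = 0" unfolding uY using i1 i2 by (simp add: lin del: integral_inner_right transpose_matrix_vector)
    finally show ?thesis .
  qed
  then have "(LINT y|\<nu>. y) = 0" by (metis inner_eq_zero_iff)
  then have \<nu>: "\<nu> \<in> centered_P2"
    using Q.prob_space_distr[OF Ym] Yi Ym by (auto simp: centered_P2_def \<nu>_def integrable_distr_eq)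
  have \<pi>: "\<pi> \<in> couplings \<mu> \<nu>"
    using Q.prob_space_distr[OF pm] pm c
    by (auto simp: couplings_def \<pi>_def \<nu>_def distr_distr[OF fs(1) pm] distr_distr[OF fs(2) pm] comp_def)
  note prodi = integrable_inner_prod(2)[OF m(1) m(1) sq(1) sq(1)] integrable_inner_prod(2)[OF m(2) m(2) sq(2) sq(2)]
    integrable_inner_prod(2)[OF m sq]
  have prod: "(LINT p|?Q. (u \<bullet> fst p) * (w \<bullet> fst p)) = u \<bullet> (Cov \<mu> *v w)"
    "(LINT p|?Q. (u \<bullet> snd p) * (w \<bullet> snd p)) = u \<bullet> w"
    "(LINT p|?Q. (u \<bullet> fst p) * (w \<bullet> snd p)) = 0" for u w
    using coupling_integral_fst[OF c, of "\<lambda>x. (u \<bullet> x) * (w \<bullet> x)"] coupling_integral_snd[OF c, of "\<lambda>x. (u \<bullet> x) * (w \<bullet> x)"]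
    by (simp_all add: bilinear_Cov[OF \<mu>, symmetric] bilinear_Cov[OF \<zeta>(1), symmetric] \<zeta>(2) pair_measure_uncorrelated[OF \<mu> \<zeta>(1)])
  have "u \<bullet> (Cov \<nu> *v w) = u \<bullet> ((M ** Cov \<mu> ** transpose M + N ** transpose N) *v w)" for u w
  proof -
    let ?a = "transpose M *v u" and ?b = "transpose N *v u" and ?a' = "transpose M *v w" and ?b' = "transpose N *v w"
    have "u \<bullet> (Cov \<nu> *v w) = (LINT p|?Q. (u \<bullet> Y p) * (w \<bullet> Y p))"
      unfolding bilinear_Cov[OF \<nu>] unfolding \<nu>_def using Ym by (simp add: integral_distr)
    also have "\<dots> = (LINT p|?Q. (?a \<bullet> fst p) * (?a' \<bullet> fst p) + (?b \<bullet> snd p) * (?b' \<bullet> snd p)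
        + (?a \<bullet> fst p) * (?b' \<bullet> snd p) + (?a' \<bullet> fst p) * (?b \<bullet> snd p))"
      by (intro Bochner_Integration.integral_cong refl) (simp only: uY, simp add: algebra_simps)
    also have "\<dots> = ?a \<bullet> (Cov \<mu> *v ?a') + ?b \<bullet> ?b'"
      using prodi by (simp add: prod del: transpose_matrix_vector)
    also have "\<dots> = u \<bullet> ((M ** Cov \<mu> ** transpose M + N ** transpose N) *v w)"
      by (simp add: inner_matrix_left matrix_vector_mult_add_rdistrib inner_add_right
          matrix_vector_mul_assoc[symmetric] del: transpose_matrix_vector)
    finally show ?thesis .
  qed
  then have cov: "Cov \<nu> = M ** Cov \<mu> ** transpose M + N ** transpose N"
    by (rule matrix_eqI_bilinear)
  have "(LINT p|\<pi>. fst p \<bullet> snd p) = (LINT p|?Q. fst p \<bullet> Y p)"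
    unfolding \<pi>_def using integral_distr[OF pm borel_measurable_inner[OF fs]] by simp
  \<comment> \<open>Writing <x, N z> coordinatewise makes it a sum of products of linear forms in x
    and in z, each with integral 0.\<close>
  also have "\<dots> = (LINT p|?Q. fst p \<bullet> (M *v fst p) + (\<Sum>i\<in>UNIV. (axis i 1 \<bullet> fst p) * (row i N \<bullet> snd p)))"
    by (simp add: Y_def inner_add_right) (simp add: inner_vec_def[of "fst _" "N *v _"] inner_axis' matrix_vector_mul_component row_def)
  also have "\<dots> = (LINT p|?Q. fst p \<bullet> (M *v fst p))"
    using prodi(3) integrable_inner_prod(1)[OF m(1) Mi(2) sq(1) Mi(1)] by (simp add: prod)
  also have "\<dots> = M \<bullet> Cov \<mu>"
  proof -
    have "(\<lambda>x. x \<bullet> (M *v x)) \<in> borel_measurable borel"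
      by (intro borel_measurable_continuous_onI continuous_intros)
    from coupling_integral_fst[OF c this] show ?thesis by (simp add: inner_Cov[OF \<mu>])
  qed
  finally show thesis using that \<nu> \<pi> cov by blast
qed

section \<open>Comparison of the two distances\<close>

lemma bures_wasserstein_le:
  assumes \<mu>: "\<mu> \<in> centered_P2" and \<nu>: "\<nu> \<in> centered_P2"
  shows "bures_wasserstein (Cov \<mu>) (Cov \<nu>) \<le> wasserstein \<mu> \<nu>"
  unfolding wasserstein_def
proof (rule cINF_greatest)
  \<comment> \<open>A lower bound passes to a real-valued infimum only over a nonempty index
    set.\<close>
  show "couplings \<mu> \<nu> \<noteq> {}" using pair_measure_coupling[OF assms] by blast
  fix \<pi> assume \<pi>: "\<pi> \<in> couplings \<mu> \<nu>"
  show "bures_wasserstein (Cov \<mu>) (Cov \<nu>) \<le> sqrt (LINT (x, y)|\<pi>. (norm (x - y))\<^sup>2)"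
    unfolding bures_wasserstein_def coupling_cost[OF assms \<pi>]
    using coupling_inner_le[OF assms \<pi>] by (simp add: trace_add trace_sub trace_scaleR)
qed

lemma wasserstein_le_coupling:
  "\<pi> \<in> couplings \<mu> \<nu> \<Longrightarrow> wasserstein \<mu> \<nu> \<le> sqrt (LINT (x, y)|\<pi>. (norm (x - y))\<^sup>2)"
  unfolding wasserstein_def
  by (rule cINF_lower) (auto intro!: bdd_belowI[of _ 0] Bochner_Integration.integral_nonneg)

text \<open>The covariance is met exactly and only the cost is approximate, so \<nu> is admissible
  for every set C that contains B.\<close>

lemma near_optimal_measure:
  assumes \<mu>: "\<mu> \<in> centered_P2" and B: "B \<in> psd" and e: "0 < e"
  obtains \<nu> where "\<nu> \<in> centered_P2" "Cov \<nu> = B"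
    "wasserstein \<mu> \<nu> \<le> sqrt (trace (Cov \<mu> + B - 2 *\<^sub>R msqrt (msqrt (Cov \<mu>) ** B ** msqrt (Cov \<mu>))) + e)"
proof -
  define K where "K = real CARD('a) + norm (msqrt B) * sqrt (real CARD('a))"
  \<comment> \<open>The cost contains -2 E<x,y>, so a defect d K in the cross moment costs 2 d K, at
    most e for this d. The 1 keeps the denominator positive.\<close>
  define d where "d = e / (2 * K + 1)"
  have K: "0 \<le> K" by (simp add: K_def)
  have d: "0 < d" "2 * (d * K) \<le> e" using K e by (simp_all add: d_def field_simps)
  obtain M where M: "B - M ** Cov \<mu> ** transpose M \<in> psd"
    "trace (msqrt (msqrt (Cov \<mu>) ** B ** msqrt (Cov \<mu>))) - d * K \<le> M \<bullet> Cov \<mu>"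
    unfolding K_def using near_optimal_matrix[OF Cov_psd[OF \<mu>] B d(1)] .
  define N where "N = msqrt (B - M ** Cov \<mu> ** transpose M)"
  have N: "N ** transpose N = B - M ** Cov \<mu> ** transpose M"
    using M(1) by (simp add: N_def msqrt_square psdD(1)[OF msqrt_psd])
  obtain \<nu> \<pi> where \<nu>: "\<nu> \<in> centered_P2" "\<pi> \<in> couplings \<mu> \<nu>"
    "Cov \<nu> = M ** Cov \<mu> ** transpose M + N ** transpose N"
    "(LINT p|\<pi>. fst p \<bullet> snd p) = M \<bullet> Cov \<mu>"
    using noisy_linear_image[OF \<mu>] .
  have cov: "Cov \<nu> = B" using \<nu>(3) N by simp
  have "wasserstein \<mu> \<nu> \<le> sqrt (trace (Cov \<mu>) + trace B - 2 * (M \<bullet> Cov \<mu>))"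
    using wasserstein_le_coupling[OF \<nu>(2)] by (simp add: coupling_cost[OF \<mu> \<nu>(1,2)] cov \<nu>(4))
  also have "\<dots> \<le> sqrt (trace (Cov \<mu> + B - 2 *\<^sub>R msqrt (msqrt (Cov \<mu>) ** B ** msqrt (Cov \<mu>))) + e)"
    unfolding real_sqrt_le_iff trace_add trace_sub trace_scaleR using M(2) d(2) by linarith
  finally show thesis using that \<nu>(1) cov by blast
qed

theorem lemmaA13:
  fixes C :: "(real^'n^'n) set" and \<mu> :: "(real^'n) measure"
  assumes "C \<subseteq> psd" and "\<mu> \<in> centered_P2"
  shows "dist_to_set wasserstein \<mu> (P_cov C) = dist_to_set bures_wasserstein (Cov \<mu>) C"
proof (rule antisym)
  \<comment> \<open>Each \<nu> in \<open>P_cov C\<close> yields the competitor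
    \<open>Cov \<nu>\<close> in C at no greater distance. In the extended reals this covers empty C,
    where both infima are infinite.\<close>
  show "dist_to_set bures_wasserstein (Cov \<mu>) C \<le> dist_to_set wasserstein \<mu> (P_cov C)"
    unfolding dist_to_set_def
    by (rule INF_mono) (use assms(2) in \<open>auto simp: P_cov_def intro: bures_wasserstein_le\<close>)
  show "dist_to_set wasserstein \<mu> (P_cov C) \<le> dist_to_set bures_wasserstein (Cov \<mu>) C"
    unfolding dist_to_set_def[of bures_wasserstein]
  proof (rule INF_greatest)
    fix B assume B: "B \<in> C"
    define t where "t = trace (Cov \<mu> + B - 2 *\<^sub>R msqrt (msqrt (Cov \<mu>) ** B ** msqrt (Cov \<mu>)))"
    have bound: "dist_to_set wasserstein \<mu> (P_cov C) \<le> ereal (sqrt (t + e))" if "0 < e" for e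
    proof -
      obtain \<nu> where \<nu>: "\<nu> \<in> centered_P2" "Cov \<nu> = B" "wasserstein \<mu> \<nu> \<le> sqrt (t + e)"
        unfolding t_def using near_optimal_measure[OF assms(2) subsetD[OF assms(1) B] \<open>0 < e\<close>] .
      then have "dist_to_set wasserstein \<mu> (P_cov C) \<le> ereal (wasserstein \<mu> \<nu>)"
        unfolding dist_to_set_def using B by (intro INF_lower) (simp add: P_cov_def)
      also have "\<dots> \<le> ereal (sqrt (t + e))" using \<nu> by simp
      finally show ?thesis .
    qed
    \<comment> \<open>The slack e sits under the root; continuity of \<open>sqrt\<close> on all of
      the reals removes it, also at t = 0.\<close>
    have "((\<lambda>e. ereal (sqrt (t + e))) \<longlongrightarrow> ereal (sqrt (t + 0))) (at_right 0)"
      by (intro tendsto_intros)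
    then have "dist_to_set wasserstein \<mu> (P_cov C) \<le> ereal (sqrt (t + 0))"
      by (rule tendsto_lowerbound) (auto intro: eventually_mono[OF eventually_at_right_less] bound)
    then show "dist_to_set wasserstein \<mu> (P_cov C) \<le> ereal (bures_wasserstein (Cov \<mu>) B)"
      by (simp add: bures_wasserstein_def t_def)
  qed
qed

end
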